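(* Let $\gamma$ be the Gaussian measure with density $\frac{1}{\sqrt{2\pi}}e^{-x^2/2}$ on $\mathbb{R}$. Let $f:\mathbb{R}\to[0,\infty)$ be a log-subharmonic $\mathcal{C}^1$ function such that $f\in L^2(\gamma)$, $Ef\in L^2(\gamma)$ and $\int f^2|\log f^2|\,d\gamma<\infty$, where $Ef(x)=xf'(x)$. Then $$\int f^2\log f^2\,d\gamma-\|f\|_{2,\gamma}^2\log\|f\|_{2,\gamma}^2\le\int f\,Ef\,d\gamma.$$
   Context: On $\mathbb{R}$, a function $f:\mathbb{R}\to[0,\infty)$ is log-subharmonic if $\log f$ is subharmonic: upper semicontinuous with values in $[-\infty,\infty)$, locally integrable, not identically $-\infty$, and satisfying $\log f(x)\le\frac12(\log f(x+y)+\log f(x-y))$ for all $x,y\in\mathbb{R}$; equivalently, $f>0$ and $\log f$ is convex. $\|f\|_{2,\gamma}=(\int f^2\,d\gamma)^{1/2}$. *)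

theory Defs
  imports "HOL-Probability.Probability"
begin

definition usc :: "('a::topological_space \<Rightarrow> ereal) \<Rightarrow> bool" where
  "usc u \<longleftrightarrow> (\<forall>c. open {x. u x < c})"

definition locally_integrable :: "(real \<Rightarrow> ereal) \<Rightarrow> bool" where
  "locally_integrable u \<longleftrightarrow>
     u \<in> borel_measurable borel \<and>
     (\<forall>K. compact K \<longrightarrow> (\<integral>\<^sup>+x. e2ennreal \<bar>u x\<bar> * indicator K x \<partial>lborel) < \<infinity>)"

(* The value infinity is excluded, so the sum below is never infinity - infinity. *)
definition subharmonic :: "(real \<Rightarrow> ereal) \<Rightarrow> bool" where
  "subharmonic u \<longleftrightarrow>
     (\<forall>x. u x < \<infinity>) \<and>
     usc u \<and>
     locally_integrable u \<and>
     (\<exists>x. u x \<noteq> -\<infinity>) \<and>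
     (\<forall>x y. u x \<le> ereal (1 / 2) * (u (x + y) + u (x - y)))"

(* Logarithm with log 0 = -infinity; the library's ln has ln 0 = 0. *)
definition ext_ln :: "real \<Rightarrow> ereal" where
  "ext_ln t = (if t > 0 then ereal (ln t) else -\<infinity>)"

definition log_subharmonic :: "(real \<Rightarrow> real) \<Rightarrow> bool" where
  "log_subharmonic f \<longleftrightarrow> (\<forall>x. 0 \<le> f x) \<and> subharmonic (\<lambda>x. ext_ln (f x))"

definition gauss :: "real measure" where
  "gauss = density lborel (\<lambda>x. ennreal (std_normal_density x))"

definition in_L2 :: "'a measure \<Rightarrow> ('a \<Rightarrow> real) \<Rightarrow> bool" where
  "in_L2 M f \<longleftrightarrow> f \<in> borel_measurable M \<and> integrable M (\<lambda>x. (f x)\<^sup>2)"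

definition L2_norm :: "'a measure \<Rightarrow> ('a \<Rightarrow> real) \<Rightarrow> real" where
  "L2_norm M f = sqrt (\<integral>x. (f x)\<^sup>2 \<partial>M)"

definition euler_op :: "(real \<Rightarrow> real) \<Rightarrow> real \<Rightarrow> real" where
  "euler_op f x = x * deriv f x"

end

theory Submission
  imports Defs
begin

text \<open>
  Write c for the integral of f^2, phi for the Gaussian density, and let mu have the density
  p = f^2 phi / c. Integration by parts bounds the right-hand side below by
  (c/2) (E_mu x^2 - 1), so it is enough that mu has at least the differential entropy of the Gaussian.
  Convexity of log f says that -log p has second derivative at most 1 (in the weak sense of
  supporting Gaussians). Hence p is at most phi at equal quantiles: the monotone transport from the
  Gaussian to mu is expanding, a reverse form of Caffarelli's contraction theorem. Integrating
  log p <= log phi along this transport compares the entropies.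
\<close>

section \<open>Laws with a positive density on the line and their monotone transport\<close>

locale positive_density =
  fixes p :: "real \<Rightarrow> real"
  assumes measurable_p [measurable]: "p \<in> borel_measurable borel"
    and pos: "\<And>x. 0 < p x"
    and nn_integral_p: "(\<integral>\<^sup>+x. ennreal (p x) \<partial>lborel) = 1"
begin

definition law :: "real measure" where
  "law = density lborel (\<lambda>x. ennreal (p x))"

lemma real_distribution_law: "real_distribution law"
  unfolding real_distribution_def real_distribution_axioms_def
  by (auto intro!: prob_spaceI simp: law_def emeasure_density nn_integral_p)

sublocale real_distribution law
  by (rule real_distribution_law)

text \<open>Moves the point \<open>x\<close> to the origin, so that two laws based at different
  points can be compared under one integral over the displacement \<open>s\<close>.\<close>

lemma emeasure_law_translate:
  assumes [measurable]: "A \<in> sets borel"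
  shows "emeasure law A = (\<integral>\<^sup>+s. ennreal (p (x + s)) * indicator A (x + s) \<partial>lborel)"
  using nn_integral_real_affine[of "\<lambda>t. ennreal (p t) * indicator A t" 1 x]
  by (simp add: law_def emeasure_density)

text \<open>The integral of a strictly positive function vanishes only over Lebesgue-null sets.
  Applied to intervals this makes the distribution function strictly increasing, applied to points
  it makes it continuous.\<close>

lemma emeasure_law_eq_0_iff:
  assumes [measurable]: "A \<in> sets borel"
  shows "emeasure law A = 0 \<longleftrightarrow> emeasure lborel A = 0"
proof -
  have "emeasure law A = 0 \<longleftrightarrow> (AE x in lborel. ennreal (p x) * indicator A x = 0)"
    by (simp add: law_def emeasure_density nn_integral_0_iff_AE)
  also have "\<dots> \<longleftrightarrow> (AE x in lborel. x \<notin> A)"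
    by (simp add: indicator_def pos ennreal_eq_0_iff not_le[THEN iffD2, OF pos])
  also have "\<dots> \<longleftrightarrow> emeasure lborel A = 0"
    by (simp add: AE_iff_measurable[OF _ refl])
  finally show ?thesis .
qed

lemma strict_mono_cdf: "strict_mono (cdf law)"
proof (rule strict_monoI)
  fix x y :: real assume "x < y"
  then have "emeasure law {x<..y} \<noteq> 0"
    by (subst emeasure_law_eq_0_iff) auto
  then have "measure law {x<..y} > 0"
    by (simp add: emeasure_eq_measure zero_less_measure_iff)
  then show "cdf law x < cdf law y"
    using cdf_diff_eq[OF \<open>x < y\<close>] by simp
qed

lemma isCont_cdf_law: "isCont (cdf law) x"
  using emeasure_law_eq_0_iff[of "{x}"] by (simp add: isCont_cdf emeasure_eq_measure)

lemma cdf_gt_0: "0 < cdf law x"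
  using cdf_nonneg[of "x - 1"] strict_monoD[OF strict_mono_cdf, of "x - 1" x] by simp

lemma cdf_lt_1: "cdf law x < 1"
  using cdf_bounded_prob[of "x + 1"] strict_monoD[OF strict_mono_cdf, of x "x + 1"] by simp

lemma cdf_surj:
  assumes "0 < t" "t < 1"
  shows "\<exists>x. cdf law x = t"
proof -
  obtain a where a: "cdf law a < t"
    using order_tendstoD(2)[OF cdf_lim_at_bot \<open>0 < t\<close>]
    by (metis eventually_at_bot_linorder order_refl)
  obtain b where b: "t < cdf law b"
    using order_tendstoD(1)[OF cdf_lim_at_top_prob \<open>t < 1\<close>]
    by (metis eventually_at_top_linorder order_refl)
  have "a \<le> b"
    using a b cdf_nondecreasing[of b a] by linarith
  then show ?thesis
    using IVT[of "cdf law" a t b] a b isCont_cdf_law by auto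
qed

lemma measure_greaterThan: "measure law {x<..} = 1 - cdf law x"
proof -
  have "{x<..} = space law - {..x}"
    by auto
  then show ?thesis
    by (simp only: cdf_def2) (rule prob_compl, simp)
qed

end

text \<open>\<open>S\<close> is the quantile function of \<open>q\<close> composed with the
  distribution function of \<open>p\<close>; it exists because both distribution functions take
  values in the open unit interval and that of \<open>q\<close> attains all of them.\<close>

lemma monotone_transport:
  assumes "positive_density p" "positive_density q"
  obtains S where "S \<in> borel_measurable borel"
    and "\<And>x. cdf (positive_density.law q) (S x) = cdf (positive_density.law p) x"
    and "distr (positive_density.law p) borel S = positive_density.law q"
proof -
  interpret P: positive_density p by fact
  interpret Q: positive_density q by fact
  obtain S where S: "\<And>x. cdf Q.law (S x) = cdf P.law x"
    using Q.cdf_surj[OF P.cdf_gt_0 P.cdf_lt_1] by metis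
  \<comment> \<open>Strict monotonicity of both distribution functions makes \<open>S\<close> pull
    half-lines back to half-lines of equal mass; this yields both measurability and the law of the
    image.\<close>
  have preimage: "\<exists>a. S -` {..t} = {..a} \<and> cdf P.law a = cdf Q.law t" for t
  proof -
    obtain a where a: "cdf P.law a = cdf Q.law t"
      using P.cdf_surj[OF Q.cdf_gt_0 Q.cdf_lt_1] by metis
    have "S x \<le> t \<longleftrightarrow> x \<le> a" for x
      using strict_mono_less_eq[OF Q.strict_mono_cdf, of "S x" t]
        strict_mono_less_eq[OF P.strict_mono_cdf, of x a] by (simp add: S a)
    then show ?thesis
      using a by (intro exI[of _ a]) auto
  qed
  have S_measurable: "S \<in> borel_measurable borel"
    by (rule borel_measurableI_le) (use preimage in \<open>auto simp: vimage_def\<close>, metis atMost_borel)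
  have "cdf (distr P.law borel S) t = cdf Q.law t" for t
    using preimage[of t] S_measurable by (auto simp: cdf_def2 measure_distr)
  then have "distr P.law borel S = Q.law"
    by (intro cdf_unique P.real_distribution_distr Q.real_distribution_law ext) (use S_measurable in simp)
  with S S_measurable that show thesis
    by blast
qed

section \<open>Comparison with the Gaussian density at equal quantiles\<close>

lemma positive_density_normal: "positive_density std_normal_density"
proof
  show "(\<integral>\<^sup>+x. ennreal (std_normal_density x) \<partial>lborel) = 1"
    by (simp add: nn_integral_eq_integral)
qed (auto intro: normal_density_pos)

lemma law_std_normal: "positive_density.law std_normal_density = gauss"
  by (simp add: positive_density.law_def[OF positive_density_normal] gauss_def)

text \<open>The log-density has slope \<open>- y\<close> at \<open>y\<close> and quadratic part
  exactly -s^2/2, so the Gaussian is the equality case of the support condition imposed on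
  \<open>p\<close> below.\<close>

lemma std_normal_density_add:
  "std_normal_density (y + s) = std_normal_density y * exp (- y * s - s\<^sup>2 / 2)"
  by (simp add: std_normal_density_def exp_add[symmetric] power2_eq_square field_simps)

text \<open>
  If p exceeded the normal density at corresponding quantiles, the supporting Gaussian
  would keep it above by a constant factor on a whole half-line, on which both laws have equal mass.
\<close>

lemma density_le_normal_at_quantile:
  assumes "positive_density p"
    and support: "\<And>s. p x * exp (m * s - s\<^sup>2 / 2) \<le> p (x + s)"
    and quantile: "cdf gauss y = cdf (positive_density.law p) x"
  shows "p x \<le> std_normal_density y"
proof (rule ccontr)
  interpret P: positive_density p by fact
  interpret G: positive_density std_normal_density by (rule positive_density_normal)
  note [simp] = law_std_normal
  \<comment> \<open>The ratio of the two densities at the base points is the constant factor by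
    which \<open>p\<close> will stay above.\<close>
  define k where "k = p x / std_normal_density y"
  assume "\<not> p x \<le> std_normal_density y"
  then have k: "k > 1"
    using G.pos[of y] by (simp add: k_def)
  \<comment> \<open>The quadratic terms agree, so only the slopes \<open>m\<close> and
    \<open>- y\<close> have to be compared.\<close>
  have dominates: "k * std_normal_density (y + s) \<le> p (x + s)" if "- y * s \<le> m * s" for s
  proof -
    have "k * std_normal_density (y + s) = p x * exp (- y * s - s\<^sup>2 / 2)"
      using G.pos[of y] by (simp add: k_def std_normal_density_add)
    also have "\<dots> \<le> p x * exp (m * s - s\<^sup>2 / 2)"
      using that P.pos[of x] by (intro mult_left_mono) auto
    finally show ?thesis
      using support[of s] by simp
  qed
  \<comment> \<open>Seen from \<open>x\<close> and \<open>y\<close>, the sets \<open>A\<close> and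
    \<open>B\<close> consist of the same displacements, so the pointwise domination
    integrates.\<close>
  have mass: "k * measure gauss B \<le> measure P.law A"
    if [measurable]: "A \<in> sets borel" "B \<in> sets borel"
      and eq: "\<And>s. x + s \<in> A \<longleftrightarrow> y + s \<in> B" and le: "\<And>s. y + s \<in> B \<Longrightarrow> - y * s \<le> m * s"
    for A B
  proof -
    have "ennreal k * emeasure gauss B
        = (\<integral>\<^sup>+s. ennreal k * (ennreal (std_normal_density (y + s)) * indicator B (y + s)) \<partial>lborel)"
      using G.emeasure_law_translate[of B y] by (simp add: nn_integral_cmult)
    also have "\<dots> \<le> (\<integral>\<^sup>+s. ennreal (p (x + s)) * indicator A (x + s) \<partial>lborel)"
    proof (rule nn_integral_mono)
      fix s
      show "ennreal k * (ennreal (std_normal_density (y + s)) * indicator B (y + s))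
          \<le> ennreal (p (x + s)) * indicator A (x + s)"
        using dominates[OF le, of s] k eq[of s]
        by (auto simp: indicator_def ennreal_mult[symmetric] intro!: ennreal_leI)
    qed
    also have "\<dots> = emeasure P.law A"
      by (simp add: P.emeasure_law_translate[of A x])
    finally show ?thesis
      using k by (simp add: P.emeasure_eq_measure G.emeasure_eq_measure[simplified]
          ennreal_mult[symmetric])
  qed
  \<comment> \<open>The larger slope decides the side: right half-lines if - y \<le> m, left ones
    otherwise. Equal quantiles give the two half-lines the same positive mass, which is incompatible
    with k > 1.\<close>
  show False
  proof (cases "- y \<le> m")
    case True
    then have "k * measure gauss {y<..} \<le> measure P.law {x<..}"
      by (intro mass) (auto intro!: mult_right_mono[of "- y" m, simplified])
    moreover have "measure gauss {y<..} = measure P.law {x<..}" "measure gauss {y<..} > 0"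
      using G.measure_greaterThan[of y] P.measure_greaterThan[of x] P.cdf_lt_1[of x] quantile by auto
    ultimately show False
      using k by simp
  next
    case False
    then have "k * measure gauss {..y} \<le> measure P.law {..x}"
      by (intro mass) (auto intro!: mult_right_mono_neg[of m "- y", simplified])
    moreover have "measure gauss {..y} = measure P.law {..x}" "measure gauss {..y} > 0"
      using G.cdf_gt_0[of y] quantile by (auto simp: cdf_def2)
    ultimately show False
      using k by simp
  qed
qed


section \<open>Gaussian integrals and the comparison of entropies\<close>

lemma integrable_gauss_iff:
  assumes "h \<in> borel_measurable borel"
  shows "integrable gauss h \<longleftrightarrow> integrable lborel (\<lambda>x. std_normal_density x * h x)"
  using assms by (simp add: gauss_def integrable_density)

lemma integral_gauss:
  assumes "h \<in> borel_measurable borel"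
  shows "(\<integral>x. h x \<partial>gauss) = (\<integral>x. std_normal_density x * h x \<partial>lborel)"
  using assms by (simp add: gauss_def integral_density)

lemma gauss_second_moment:
  shows "integrable gauss (\<lambda>x. x\<^sup>2)" and "(\<integral>x. x\<^sup>2 \<partial>gauss) = 1"
  using std_normal_moment_even[of 1]
  by (simp_all add: integrable_gauss_iff integral_gauss has_bochner_integral_iff)

lemma prob_space_gauss: "prob_space gauss"
  using prob_space_normal_density by (simp add: gauss_def)

lemma ln_std_normal_density: "ln (std_normal_density x) = - ln (2 * pi) / 2 - x\<^sup>2 / 2"
  by (simp add: std_normal_density_def ln_div ln_sqrt)

text \<open>
  The monotone transport from the law of p to the Gaussian turns the pointwise comparison of
  densities at equal quantiles into a comparison of differential entropies.
\<close>

lemma integral_ln_density_le: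
  assumes "positive_density p"
    and support: "\<And>x. \<exists>m. \<forall>s. p x * exp (m * s - s\<^sup>2 / 2) \<le> p (x + s)"
    and integrable: "integrable (positive_density.law p) (\<lambda>x. ln (p x))"
  shows "(\<integral>x. ln (p x) \<partial>positive_density.law p) \<le> - (1 + ln (2 * pi)) / 2"
proof -
  interpret P: positive_density p by fact
  interpret G: prob_space gauss by (rule prob_space_gauss)
  obtain S where [measurable]: "S \<in> borel_measurable borel"
    and quantile: "\<And>x. cdf gauss (S x) = cdf P.law x"
    and distr: "distr P.law borel S = gauss"
    using monotone_transport[OF \<open>positive_density p\<close> positive_density_normal]
    unfolding law_std_normal by metis
  have le: "ln (p x) \<le> ln (std_normal_density (S x))" for x
  proof -
    obtain m where "\<And>s. p x * exp (m * s - s\<^sup>2 / 2) \<le> p (x + s)"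
      using support by blast
    then have "p x \<le> std_normal_density (S x)"
      by (rule density_le_normal_at_quantile[OF \<open>positive_density p\<close> _ quantile])
    then show ?thesis
      using P.pos[of x] by simp
  qed
  \<comment> \<open>Along \<open>distr\<close> this becomes integrability of the transported
    log-density under \<open>P.law\<close>, which monotonicity of the Bochner integral
    requires.\<close>
  have int: "integrable gauss (\<lambda>y. ln (std_normal_density y))"
    unfolding ln_std_normal_density
    by (intro Bochner_Integration.integrable_diff) (use gauss_second_moment in auto)
  have "(\<integral>x. ln (p x) \<partial>P.law) \<le> (\<integral>x. ln (std_normal_density (S x)) \<partial>P.law)"
    using integrable le int[folded distr] by (intro integral_mono) (auto simp: integrable_distr_eq)
  also have "\<dots> = (\<integral>y. ln (std_normal_density y) \<partial>gauss)"
    unfolding distr[symmetric] by (rule integral_distr[symmetric]) simp_all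
  also have "\<dots> = - (1 + ln (2 * pi)) / 2"
    unfolding ln_std_normal_density
    by (subst Bochner_Integration.integral_diff)
      (use gauss_second_moment in \<open>auto simp: field_simps G.prob_space\<close>)
  finally show ?thesis .
qed

section \<open>Integration by parts against the Gaussian\<close>

text \<open>
  Only an inequality, since the boundary terms x g(x) phi(x) are merely known to have a sign;
  this sign also yields the second moment.
\<close>

lemma gaussian_second_moment_le:
  fixes g g' :: "real \<Rightarrow> real"
  assumes deriv: "\<And>x. (g has_real_derivative g' x) (at x)"
    and cont: "\<And>x. isCont g' x"
    and nonneg: "\<And>x. 0 \<le> g x"
    and int_g: "integrable gauss g"
    and int_g': "integrable gauss (\<lambda>x. x * g' x)"
  shows "integrable gauss (\<lambda>x. x\<^sup>2 * g x)"
    and "(\<integral>x. x\<^sup>2 * g x \<partial>gauss) \<le> (\<integral>x. g x \<partial>gauss) + (\<integral>x. x * g' x \<partial>gauss)"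
proof -
  let ?\<phi> = std_normal_density
  \<comment> \<open>Since the derivative of phi is -x phi, the difference A - B is the derivative of
    x g(x) phi(x).\<close>
  define A where "A x = ?\<phi> x * (g x + x * g' x)" for x
  define B where "B x = ?\<phi> x * (x\<^sup>2 * g x)" for x
  have cont_g: "isCont g x" for x
    using deriv DERIV_isCont by blast
  have [measurable]: "g \<in> borel_measurable borel" "g' \<in> borel_measurable borel"
    using cont cont_g by (auto intro!: borel_measurable_continuous_onI continuous_at_imp_continuous_on)
  have deriv_phi: "(?\<phi> has_real_derivative - x * ?\<phi> x) (at x)" for x
  proof -
    have "((\<lambda>x. exp (- x\<^sup>2 / 2)) has_real_derivative - x * exp (- x\<^sup>2 / 2)) (at x)"
      by (auto intro!: derivative_eq_intros)
    from DERIV_cmult[OF this, of "1 / sqrt (2 * pi)"] show ?thesis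
      by (simp add: std_normal_density_def[abs_def])
  qed
  have cont_phi: "isCont ?\<phi> x" for x
    using deriv_phi DERIV_isCont by blast
  have contA: "isCont A x" and contB: "isCont B x" for x
    unfolding A_def B_def by (intro continuous_intros cont cont_g cont_phi)+
  have B_nonneg: "0 \<le> B x" for x
    by (simp add: B_def nonneg)
  have intA: "integrable lborel A"
    using Bochner_Integration.integrable_add[OF int_g int_g']
    by (simp add: A_def[abs_def] integrable_gauss_iff)
  let ?I = "\<lambda>n::nat. {- real n..real n}"
  have int_trunc: "integrable lborel (\<lambda>x. h x * indicator (?I n) x)"
    if "\<And>x. isCont h x" for h :: "real \<Rightarrow> real" and n
    by (rule borel_integrable_atLeastAtMost) (rule that)
  have lim_trunc: "(\<lambda>n. h x * indicator (?I n) x) \<longlonglongrightarrow> h x" for h :: "real \<Rightarrow> real" and x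
  proof (rule tendsto_eventually)
    obtain N where "\<bar>x\<bar> \<le> real N"
      using real_arch_simple by blast
    then show "\<forall>\<^sub>F n in sequentially. h x * indicator (?I n) x = h x"
      by (intro eventually_sequentiallyI[of N]) (auto simp: indicator_def)
  qed
  have trunc_le: "(\<integral>x. B x * indicator (?I n) x \<partial>lborel) \<le> (\<integral>x. A x * indicator (?I n) x \<partial>lborel)" for n
  proof -
    let ?F = "\<lambda>x. x * g x * ?\<phi> x"
    have "(\<integral>x. (A x - B x) * indicator (?I n) x \<partial>lborel) = ?F (real n) - ?F (- real n)"
    proof (rule integral_FTC_Icc_real)
      fix x
      show "(?F has_real_derivative A x - B x) (at x)"
        by (auto intro!: derivative_eq_intros deriv deriv_phi
            simp: A_def B_def algebra_simps power2_eq_square)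
      show "isCont (\<lambda>x. A x - B x) x"
        by (intro continuous_intros contA contB)
    qed simp
    \<comment> \<open>The boundary terms add up to n (g(n) phi(n) + g(-n) phi(-n)).\<close>
    also have "\<dots> \<ge> 0"
      by (simp add: nonneg)
    finally show ?thesis
      using int_trunc[OF contA, of n] int_trunc[OF contB, of n] by (simp add: left_diff_distrib)
  qed
  \<comment> \<open>\<open>A\<close> is integrable, so dominated convergence applies.
    \<open>B\<close> is not yet known to be integrable; its truncated integrals increase and are
    bounded through those of \<open>A\<close>, so monotone convergence gives integrability and the
    bound together.\<close>
  have limA: "(\<lambda>n. \<integral>x. A x * indicator (?I n) x \<partial>lborel) \<longlonglongrightarrow> integral\<^sup>L lborel A"
  proof (rule integral_dominated_convergence[where w = "\<lambda>x. \<bar>A x\<bar>"])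
    show "A \<in> borel_measurable lborel" "integrable lborel (\<lambda>x. \<bar>A x\<bar>)"
      using intA by auto
    show "(\<lambda>x. A x * indicator (?I n) x) \<in> borel_measurable lborel" for n
      using intA by measurable
    show "AE x in lborel. (\<lambda>n. A x * indicator (?I n) x) \<longlonglongrightarrow> A x"
      by (simp only: lim_trunc) simp
  qed (auto simp: indicator_def)
  have mono: "mono (\<lambda>n. B x * indicator (?I n) x)" for x
    by (rule monoI) (auto simp: indicator_def B_nonneg)
  have incseq: "incseq (\<lambda>n. \<integral>x. B x * indicator (?I n) x \<partial>lborel)"
    by (intro monoI integral_mono int_trunc contB monoD[OF mono])
  have "Bseq (\<lambda>n. \<integral>x. A x * indicator (?I n) x \<partial>lborel)"
    using limA by (intro convergent_imp_Bseq convergentI)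
  then obtain C where C: "\<And>n. norm (\<integral>x. A x * indicator (?I n) x \<partial>lborel) \<le> C"
    unfolding Bseq_def by blast
  have "\<forall>n. (\<integral>x. B x * indicator (?I n) x \<partial>lborel) \<le> C"
    using trunc_le C by (auto intro!: order_trans[OF trunc_le order_trans[OF abs_ge_self]])
  with incseq obtain L where L: "(\<lambda>n. \<integral>x. B x * indicator (?I n) x \<partial>lborel) \<longlonglongrightarrow> L"
    by (elim incseq_convergent)
  have [measurable]: "B \<in> borel_measurable lborel"
    unfolding B_def by measurable
  have "has_bochner_integral lborel B L"
    by (rule has_bochner_integral_monotone_convergence[OF int_trunc[OF contB] _ _ L])
      (auto simp: mono lim_trunc)
  moreover have "L \<le> integral\<^sup>L lborel A"
    by (rule LIMSEQ_le[OF L limA]) (use trunc_le in auto)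
  moreover have "integral\<^sup>L lborel A = (\<integral>x. g x \<partial>gauss) + (\<integral>x. x * g' x \<partial>gauss)"
    using Bochner_Integration.integral_add[OF int_g int_g'] by (simp add: A_def[abs_def] integral_gauss)
  ultimately show "integrable gauss (\<lambda>x. x\<^sup>2 * g x)"
    "(\<integral>x. x\<^sup>2 * g x \<partial>gauss) \<le> (\<integral>x. g x \<partial>gauss) + (\<integral>x. x * g' x \<partial>gauss)"
    by (auto simp: has_bochner_integral_iff integrable_gauss_iff integral_gauss B_def[abs_def])
qed

section \<open>Positivity and tangents of log-subharmonic functions\<close>

text \<open>Every z is the midpoint of x and 2z - x, so a value -\<infinity> of the logarithm at x
  would spread to all z.\<close>

lemma log_subharmonic_pos:
  assumes "log_subharmonic f"
  shows "0 < f x"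
proof (rule ccontr)
  assume "\<not> 0 < f x"
  then have x: "ext_ln (f x) = -\<infinity>"
    by (simp add: ext_ln_def)
  obtain z where z: "ext_ln (f z) \<noteq> -\<infinity>"
    using assms unfolding log_subharmonic_def subharmonic_def by blast
  have "ext_ln (f z) \<le> ereal (1 / 2) * (ext_ln (f (z + (x - z))) + ext_ln (f (z - (x - z))))"
    using assms unfolding log_subharmonic_def subharmonic_def by blast
  also have "\<dots> = -\<infinity>"
    using x by (simp add: ext_ln_def)
  finally show False
    using z by simp
qed

lemma log_subharmonic_midpoint:
  assumes "log_subharmonic f"
  shows "ln (f x) \<le> (ln (f (x + y)) + ln (f (x - y))) / 2"
proof -
  have "ext_ln (f x) \<le> ereal (1 / 2) * (ext_ln (f (x + y)) + ext_ln (f (x - y)))"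
    using assms unfolding log_subharmonic_def subharmonic_def by blast
  then show ?thesis
    by (simp add: ext_ln_def log_subharmonic_pos[OF assms])
qed

text \<open>Halving the step towards \<open>x\<close> can only decrease the difference quotient, and
  along the dyadic steps it tends to \<open>D * s\<close>. Midpoint convexity thus gives the tangent
  bound directly.\<close>

lemma midpoint_convex_tangent:
  fixes h :: "real \<Rightarrow> real"
  assumes mid: "\<And>x y. h x \<le> (h (x + y) + h (x - y)) / 2"
    and deriv: "(h has_real_derivative D) (at x)"
  shows "h x + D * s \<le> h (x + s)"
proof -
  have halving: "2 ^ n * (h (x + s / 2 ^ n) - h x) \<le> h (x + s) - h x" for n
  proof (induction n)
    case (Suc n)
    have "h (x + s / 2 ^ Suc n) \<le> (h (x + s / 2 ^ n) + h x) / 2"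
    proof -
      have "x + s / 2 ^ Suc n + s / 2 ^ Suc n = x + s / 2 ^ n" "x + s / 2 ^ Suc n - s / 2 ^ Suc n = x"
        by (simp_all add: field_simps)
      then show ?thesis
        using mid[of "x + s / 2 ^ Suc n" "s / 2 ^ Suc n"] by metis
    qed
    then have "2 ^ Suc n * (h (x + s / 2 ^ Suc n) - h x)
        \<le> 2 ^ Suc n * ((h (x + s / 2 ^ n) + h x) / 2 - h x)"
      by (intro mult_left_mono) auto
    also have "\<dots> = 2 ^ n * (h (x + s / 2 ^ n) - h x)"
      by (simp add: field_simps)
    finally show ?case
      using Suc by linarith
  qed simp
  have "((\<lambda>t. h (x + s * t)) has_real_derivative D * s) (at 0)"
    using deriv by (intro DERIV_chain2[where f = h]) (auto intro!: derivative_eq_intros)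
  then have "((\<lambda>t. (h (x + s * t) - h x) / t) \<longlongrightarrow> D * s) (at 0)"
    by (simp add: DERIV_def)
  moreover have "filterlim (\<lambda>n. (1 / 2) ^ n :: real) (at 0) sequentially"
    unfolding filterlim_at by (auto intro!: LIMSEQ_realpow_zero)
  ultimately have "(\<lambda>n. (h (x + s * (1 / 2) ^ n) - h x) / (1 / 2) ^ n) \<longlonglongrightarrow> D * s"
    by (rule filterlim_compose)
  then have "D * s \<le> h (x + s) - h x"
    by (rule LIMSEQ_le_const2) (use halving in \<open>auto simp: power_divide mult.commute\<close>)
  then show ?thesis
    by simp
qed

text \<open>The tangent line of log f, exponentiated; its square will supply the supporting
  Gaussians of the density proportional to f^2 phi.\<close>

lemma log_subharmonic_tangent:
  assumes "log_subharmonic f" "(f has_real_derivative D) (at x)"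
  shows "f x * exp (D / f x * s) \<le> f (x + s)"
proof -
  note pos = log_subharmonic_pos[OF assms(1)]
  have "((\<lambda>x. ln (f x)) has_real_derivative D / f x) (at x)"
    using pos assms(2) by (auto intro!: derivative_eq_intros)
  then have "ln (f x) + D / f x * s \<le> ln (f (x + s))"
    by (rule midpoint_convex_tangent[where h = "\<lambda>x. ln (f x)", OF log_subharmonic_midpoint[OF assms(1)]])
  then have "exp (ln (f x) + D / f x * s) \<le> exp (ln (f (x + s)))"
    by simp
  then show ?thesis
    by (simp add: exp_add pos del: exp_le_cancel_iff)
qed

section \<open>The entropy inequality for the density proportional to f^2 phi\<close>

theorem theorem5p7:
  fixes f :: "real \<Rightarrow> real"
  assumes "\<And>x. 0 \<le> f x"
    and "log_subharmonic f"
    and "f C1_differentiable_on UNIV"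
    and "in_L2 gauss f"
    and "in_L2 gauss (euler_op f)"
    and "integrable gauss (\<lambda>x. (f x)\<^sup>2 * \<bar>ln ((f x)\<^sup>2)\<bar>)"
  shows "(\<integral>x. (f x)\<^sup>2 * ln ((f x)\<^sup>2) \<partial>gauss)
           - (L2_norm gauss f)\<^sup>2 * ln ((L2_norm gauss f)\<^sup>2)
         \<le> (\<integral>x. f x * euler_op f x \<partial>gauss)"
proof -
  interpret G: positive_density std_normal_density
    rewrites "positive_density.law std_normal_density \<equiv> gauss"
    by (simp_all add: positive_density_normal law_std_normal)
  note f_pos = log_subharmonic_pos[OF assms(2)]
  obtain f' where deriv: "\<And>x. (f has_real_derivative f' x) (at x)" and "continuous_on UNIV f'"
    using assms(3) by (auto simp: C1_differentiable_on_def has_real_derivative_iff_has_vector_derivative)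
  then have cont': "isCont f' x" for x
    by (simp add: continuous_on_eq_continuous_at)
  have cont: "isCont f x" for x
    using deriv DERIV_isCont by blast
  have [measurable]: "f \<in> borel_measurable borel" "f' \<in> borel_measurable borel"
    using cont cont' by (auto intro!: borel_measurable_continuous_onI continuous_at_imp_continuous_on)
  have euler: "euler_op f x = x * f' x" for x
    using DERIV_imp_deriv[OF deriv] by (simp add: euler_op_def)
  have int_sq: "integrable gauss (\<lambda>x. (f x)\<^sup>2)" and int_euler_sq: "integrable gauss (\<lambda>x. (x * f' x)\<^sup>2)"
    using assms(4,5) by (simp_all add: in_L2_def euler)
  have int_ln: "integrable gauss (\<lambda>x. (f x)\<^sup>2 * ln ((f x)\<^sup>2))"
    by (rule Bochner_Integration.integrable_bound[OF assms(6)]) (auto simp: abs_mult)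
  have int_euler: "integrable gauss (\<lambda>x. f x * (x * f' x))"
  proof (rule Bochner_Integration.integrable_bound[OF Bochner_Integration.integrable_add[OF int_sq int_euler_sq]])
    have "\<bar>a * b\<bar> \<le> a\<^sup>2 + b\<^sup>2" for a b :: real
      using sum_squares_bound[of "\<bar>a\<bar>" "\<bar>b\<bar>"] abs_ge_zero[of "a * b"]
      unfolding abs_mult power2_abs by linarith
    then show "AE x in gauss. norm (f x * (x * f' x)) \<le> norm ((f x)\<^sup>2 + (x * f' x)\<^sup>2)"
      by (simp add: abs_of_nonneg)
  qed simp
  define c where "c = (\<integral>x. (f x)\<^sup>2 \<partial>gauss)"
  have "c \<noteq> 0"
  proof
    assume "c = 0"
    then have "AE x in gauss. False"
      using integral_nonneg_eq_0_iff_AE[OF int_sq] f_pos by (simp add: c_def less_imp_neq[symmetric])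
    then show False
      by simp
  qed
  then have c: "c > 0"
    by (simp add: c_def order_less_le)
  define p where "p x = std_normal_density x * ((f x)\<^sup>2 / c)" for x
  have p_pos: "0 < p x" for x
    unfolding p_def by (intro mult_pos_pos divide_pos_pos G.pos zero_less_power f_pos c)
  have density_p: "density lborel (\<lambda>x. ennreal (p x)) = density gauss (\<lambda>x. ennreal ((f x)\<^sup>2 / c))"
    unfolding p_def ennreal_mult'[OF normal_density_nonneg] gauss_def
    by (rule density_density_eq[symmetric]) measurable
  interpret P: positive_density p
  proof
    show "p \<in> borel_measurable borel"
      unfolding p_def by measurable
    have "emeasure (density lborel (\<lambda>x. ennreal (p x))) UNIV = (\<integral>\<^sup>+x. ennreal ((f x)\<^sup>2 / c) \<partial>gauss)"
      unfolding density_p by (simp add: emeasure_density)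
    also have "\<dots> = 1"
      using int_sq c by (subst nn_integral_eq_integral) (auto simp: c_def)
    finally show "(\<integral>\<^sup>+x. ennreal (p x) \<partial>lborel) = 1"
      using \<open>p \<in> borel_measurable borel\<close> by (simp add: emeasure_density)
  qed (rule p_pos)
  \<comment> \<open>Squaring doubles the slope f'(x)/f(x) of log f, and the Gaussian factor
    contributes -x to the slope together with the term -s^2/2.\<close>
  have support: "\<exists>m. \<forall>s. p x * exp (m * s - s\<^sup>2 / 2) \<le> p (x + s)" for x
  proof (intro exI allI)
    fix s
    have "(f x * exp (f' x / f x * s))\<^sup>2 \<le> (f (x + s))\<^sup>2"
      using log_subharmonic_tangent[OF assms(2) deriv] f_pos[of x] by (intro power_mono) auto
    then have "std_normal_density (x + s) * ((f x * exp (f' x / f x * s))\<^sup>2 / c) \<le> p (x + s)"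
      unfolding p_def using c by (intro mult_left_mono divide_right_mono) auto
    also have "std_normal_density (x + s) * ((f x * exp (f' x / f x * s))\<^sup>2 / c)
        = p x * (exp (- x * s - s\<^sup>2 / 2) * exp (2 * (f' x / f x * s)))"
      unfolding p_def std_normal_density_add exp_double by (simp add: power_mult_distrib)
    also have "\<dots> = p x * exp ((2 * (f' x / f x) - x) * s - s\<^sup>2 / 2)"
      unfolding exp_add[symmetric] by (simp add: algebra_simps)
    finally show "p x * exp ((2 * (f' x / f x) - x) * s - s\<^sup>2 / 2) \<le> p (x + s)" .
  qed
  define H where "H = (\<integral>x. (f x)\<^sup>2 * ln ((f x)\<^sup>2) \<partial>gauss)"
  define J where "J = (\<integral>x. f x * (x * f' x) \<partial>gauss)"
  define M where "M = (\<integral>x. x\<^sup>2 * (f x)\<^sup>2 \<partial>gauss)"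
  have deriv_sq: "((\<lambda>x. (f x)\<^sup>2) has_real_derivative 2 * f x * f' x) (at x)" for x
    by (auto intro!: derivative_eq_intros deriv)
  have cont_sq: "isCont (\<lambda>x. 2 * f x * f' x) x" for x
    by (intro continuous_intros cont cont')
  have "integrable gauss (\<lambda>x. 2 * (f x * (x * f' x)))"
    using int_euler by simp
  then have int_x_deriv: "integrable gauss (\<lambda>x. x * (2 * f x * f' x))"
    by (simp add: ac_simps)
  \<comment> \<open>With g = f^2 the integration by parts also shows that the integral
    \<open>M\<close> exists.\<close>
  note second_moment = gaussian_second_moment_le[OF deriv_sq cont_sq zero_le_power2 int_sq int_x_deriv]
  have "(\<integral>x. x * (2 * f x * f' x) \<partial>gauss) = 2 * J"
    unfolding J_def by (subst integral_mult_right_zero[symmetric]) (simp add: ac_simps)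
  then have moment_le: "M \<le> c + 2 * J"
    using second_moment(2) by (simp add: M_def c_def)
  \<comment> \<open>Splitting log p into the logarithms of f^2, phi and c expresses the entropy of
    \<open>P.law\<close> through \<open>H\<close>, \<open>M\<close> and \<open>c\<close>.\<close>
  have ln_p: "(f x)\<^sup>2 / c * ln (p x) = ((f x)\<^sup>2 * ln ((f x)\<^sup>2) - x\<^sup>2 * (f x)\<^sup>2 / 2
      - (ln c + ln (2 * pi) / 2) * (f x)\<^sup>2) / c" for x
  proof -
    have "ln (p x) = ln (std_normal_density x) + ln ((f x)\<^sup>2 / c)"
      unfolding p_def by (intro ln_mult_pos divide_pos_pos G.pos zero_less_power f_pos c)
    also have "ln ((f x)\<^sup>2 / c) = ln ((f x)\<^sup>2) - ln c"
      by (intro ln_divide_pos zero_less_power f_pos c)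
    finally have *: "ln (p x) = ln ((f x)\<^sup>2) - x\<^sup>2 / 2 - (ln c + ln (2 * pi) / 2)"
      unfolding ln_std_normal_density by simp
    show ?thesis
      unfolding * using c by (simp add: field_simps)
  qed
  have int_ln_p: "integrable gauss (\<lambda>x. (f x)\<^sup>2 / c * ln (p x))"
    unfolding ln_p using int_ln second_moment(1) int_sq by auto
  have "integrable P.law (\<lambda>x. ln (p x))"
    unfolding P.law_def density_p using int_ln_p c by (subst integrable_density) auto
  then have "(\<integral>x. ln (p x) \<partial>P.law) \<le> - (1 + ln (2 * pi)) / 2"
    by (intro integral_ln_density_le support P.positive_density_axioms)
  moreover have "(\<integral>x. ln (p x) \<partial>P.law) = (\<integral>x. (f x)\<^sup>2 / c * ln (p x) \<partial>gauss)"
    unfolding P.law_def density_p using c by (subst integral_density) auto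
  moreover have "\<dots> = (H - M / 2
      - (ln c + ln (2 * pi) / 2) * c) / c"
    unfolding ln_p using int_ln second_moment(1) int_sq by (simp add: H_def M_def c_def)
  ultimately have "H - M / 2
      - (ln c + ln (2 * pi) / 2) * c \<le> - (1 + ln (2 * pi)) / 2 * c"
    using c by (simp add: pos_divide_le_eq)
  \<comment> \<open>The terms c ln(2 pi)/2 on both sides cancel; the Gaussian second moment leaves
    -c/2.\<close>
  then have "H - c * ln c \<le> (M - c) / 2"
    by (simp add: field_simps)
  also have "(M - c) / 2 \<le> J"
    using moment_le by simp
  finally have "H - c * ln c \<le> J" .
  moreover have "(L2_norm gauss f)\<^sup>2 = c"
    using c by (simp add: L2_norm_def c_def)
  ultimately show ?thesis
    by (simp add: euler H_def J_def)
qed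

end
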